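(* Let $f$ be convex and $L_f$-smooth on the closed convex (possibly unbounded) set $Q\subseteq\mathbb{R}^n$, let $\widetilde\nabla f$ satisfy $\|\widetilde\nabla f(x)-\nabla f(x)\|_2\le\delta$ for all $x\in Q$, and assume that $\|\tilde x_0-x^*\|_2\le R$ for some $R$. Run Algorithm STM (described in the context, with $\mu_\tau=0$). Let $\varepsilon>0$ be the desired solution accuracy and let $N$ be the first iteration (smallest index $N\ge 0$) such that $$f(x_N)-f(x^* )\le\frac{\delta_2}{A_N}\sum_{j=0}^{N}A_j+3R\delta_1+\varepsilon.$$ Then for all $k\in\{0,\dots,N-1\}$ one has $\tilde R_k\le R$. Moreover, $$N\le N_{\max}:=\left\lceil\sqrt{\frac{2LR^2}{\varepsilon}}\right\rceil.$$
   Context: Setting: $Q\subseteq\mathbb{R}^n$ is closed and convex, not necessarily bounded; the problem is $\min_{x\in Q}f(x)$, and $x^*$ is a solution (if not unique, the one closest to $x_{start}$). $f$ is $L_f$-smooth: $\|\nabla f(x)-\nabla f(y)\|_2\le L_f\|x-y\|_2$ for all $x,y\in Q$; and convex: $f(x)+\langle\nabla f(x),y-x\rangle\le f(y)$ for all $x,y\in Q$ (the case of strong convexity parameter $\mu=0$). Constants: $L=2L_f$, $\delta_1=\delta$, $\delta_2=\delta^2/L$. Algorithm STM with $\mu_\tau=0$, $x_{start}\in Q$: set $\tilde x_0=x_{start}$, $\alpha_0=A_0=1/L$, $\psi_0(x)=\frac12\|x-\tilde x_0\|_2^2+\alpha_0\left(f(\tilde x_0)+\langle\widetilde\nabla f(\tilde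 x_0),x-\tilde x_0\rangle\right)$, $z_0=\arg\min_{y\in Q}\psi_0(y)$, $x_0=z_0$. For $k=1,2,\dots$: let $\alpha_k=\frac{1}{2L}+\sqrt{\frac{1}{4L^2}+\frac{A_{k-1}}{L}}$ (the positive root of $A_{k-1}+\alpha_k=L\alpha_k^2$), $A_k=A_{k-1}+\alpha_k$, $\tilde x_k=\frac{A_{k-1}x_{k-1}+\alpha_kz_{k-1}}{A_k}$, $\psi_k(x)=\psi_{k-1}(x)+\alpha_k\left(f(\tilde x_k)+\langle\widetilde\nabla f(\tilde x_k),x-\tilde x_k\rangle\right)$, $z_k=\arg\min_{y\in Q}\psi_k(y)$, $x_k=\frac{A_{k-1}x_{k-1}+\alpha_kz_k}{A_k}$. Notation: $\tilde R_k=\max_{0\le j\le k}\max\{\|z_j-x^*\|_2,\|x_j-x^*\|_2,\|\tilde x_j-x^*\|_2\}$. *)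

theory Defs
  imports "HOL-Analysis.Analysis"
begin

text \<open>
  The gradient is taken relative to \<open>Q\<close>, so \<open>f\<close> only matters on \<open>Q\<close>.  At an interior
  point this is the usual gradient; a gradient of an extension of \<open>f\<close> to a neighbourhood
  of \<open>Q\<close> also qualifies.
\<close>
definition has_gradient_on ::
  "(real^'n \<Rightarrow> real) \<Rightarrow> (real^'n \<Rightarrow> real^'n) \<Rightarrow> (real^'n) set \<Rightarrow> bool" where
  "has_gradient_on f grad Q \<longleftrightarrow>
     (\<forall>x\<in>Q. (f has_derivative (\<lambda>h. grad x \<bullet> h)) (at x within Q))"

definition L_smooth_on ::
  "real \<Rightarrow> (real^'n \<Rightarrow> real^'n) \<Rightarrow> (real^'n) set \<Rightarrow> bool" where
  "L_smooth_on Lf grad Q \<longleftrightarrow> (\<forall>x\<in>Q. \<forall>y\<in>Q. norm (grad x - grad y) \<le> Lf * norm (x - y))"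

definition first_order_convex_on ::
  "(real^'n \<Rightarrow> real) \<Rightarrow> (real^'n \<Rightarrow> real^'n) \<Rightarrow> (real^'n) set \<Rightarrow> bool" where
  "first_order_convex_on f grad Q \<longleftrightarrow> (\<forall>x\<in>Q. \<forall>y\<in>Q. f x + grad x \<bullet> (y - x) \<le> f y)"

definition solution :: "(real^'n \<Rightarrow> real) \<Rightarrow> (real^'n) set \<Rightarrow> real^'n \<Rightarrow> bool" where
  "solution f Q x \<longleftrightarrow> is_arg_min f (\<lambda>y. y \<in> Q) x"

definition closest_solution ::
  "(real^'n \<Rightarrow> real) \<Rightarrow> (real^'n) set \<Rightarrow> real^'n \<Rightarrow> real^'n \<Rightarrow> bool" where
  "closest_solution f Q x_start x \<longleftrightarrow> is_arg_min (\<lambda>y. norm (y - x_start)) (solution f Q) x"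

fun stm_\<alpha> :: "real \<Rightarrow> nat \<Rightarrow> real" and stm_A :: "real \<Rightarrow> nat \<Rightarrow> real" where
  "stm_\<alpha> L 0 = 1 / L"
| "stm_\<alpha> L (Suc k) = 1 / (2 * L) + sqrt (1 / (4 * L\<^sup>2) + stm_A L k / L)"
| "stm_A L 0 = 1 / L"
| "stm_A L (Suc k) = stm_A L k + stm_\<alpha> L (Suc k)"

context
  fixes Q :: "(real^'n) set"
    and f :: "real^'n \<Rightarrow> real"
    and g :: "real^'n \<Rightarrow> real^'n"
    and L :: real
    and x_start :: "real^'n"
begin

text \<open>
  Algorithm STM with \<open>\<mu>\<^sub>\<tau> = 0\<close>; \<open>g\<close> is the inexact gradient and \<open>stm_y\<close> is the sequence
  usually written as \<open>x\<close> with a tilde.  For \<open>L > 0\<close> and \<open>Q\<close> nonempty, closed and convex,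
  every \<open>stm_\<psi> k\<close> has exactly one minimizer over \<open>Q\<close>, so the choice made by
  \<open>arg_min_on\<close> is immaterial.
\<close>
fun stm_y :: "nat \<Rightarrow> real^'n"
  and stm_\<psi> :: "nat \<Rightarrow> real^'n \<Rightarrow> real"
  and stm_z :: "nat \<Rightarrow> real^'n"
  and stm_x :: "nat \<Rightarrow> real^'n" where
  "stm_y 0 = x_start"
| "stm_y (Suc k) = (stm_A L k *\<^sub>R stm_x k + stm_\<alpha> L (Suc k) *\<^sub>R stm_z k) /\<^sub>R stm_A L (Suc k)"
| "stm_\<psi> 0 = (\<lambda>x. 1/2 * (norm (x - stm_y 0))\<^sup>2
      + stm_\<alpha> L 0 * (f (stm_y 0) + g (stm_y 0) \<bullet> (x - stm_y 0)))"
| "stm_\<psi> (Suc k) = (\<lambda>x. stm_\<psi> k x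
      + stm_\<alpha> L (Suc k) * (f (stm_y (Suc k)) + g (stm_y (Suc k)) \<bullet> (x - stm_y (Suc k))))"
| "stm_z k = arg_min_on (stm_\<psi> k) Q"
| "stm_x 0 = stm_z 0"
| "stm_x (Suc k) = (stm_A L k *\<^sub>R stm_x k + stm_\<alpha> L (Suc k) *\<^sub>R stm_z (Suc k)) /\<^sub>R stm_A L (Suc k)"

definition stm_R :: "real^'n \<Rightarrow> nat \<Rightarrow> real" where
  "stm_R xs k = (MAX j\<in>{0..k}.
     Max {norm (stm_z j - xs), norm (stm_x j - xs), norm (stm_y j - xs)})"

end

definition first_index :: "(nat \<Rightarrow> bool) \<Rightarrow> nat \<Rightarrow> bool" where
  "first_index P N \<longleftrightarrow> P N \<and> (\<forall>m<N. \<not> P m)"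

end

theory Submission imports Defs begin

text \<open>
  The estimating functions \<open>\<psi>\<^sub>k\<close> satisfy
  \<open>A\<^sub>k f(x\<^sub>k) \<le> min\<^sub>Q \<psi>\<^sub>k + \<delta>\<^sub>2 \<Sum>\<^sub>j A\<^sub>j + \<delta> \<Sum>\<^sub>j \<alpha>\<^sub>j \<parallel>y\<^sub>j - z\<^sub>j\<^sub>-\<^sub>1\<parallel>\<close>, and convexity bounds
  \<open>\<psi>\<^sub>k(x\<^sup>*)\<close> by \<open>R\<^sup>2 / 2 + A\<^sub>k f(x\<^sup>*) + \<delta> \<Sum>\<^sub>j \<alpha>\<^sub>j \<parallel>y\<^sub>j - x\<^sup>*\<parallel>\<close>.  Since \<open>\<psi>\<^sub>k\<close> is
  1-strongly convex, the gap between \<open>\<psi>\<^sub>k(x\<^sup>*)\<close> and the minimum controls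
  \<open>\<parallel>z\<^sub>k - x\<^sup>*\<parallel>\<^sup>2 / 2\<close>.  As long as all earlier points lie in the ball of radius \<open>R\<close>
  around \<open>x\<^sup>*\<close>, the two sums contribute at most \<open>(2R + R) \<delta> A\<^sub>k\<close>, so failure of the
  stopping test at \<open>k\<close> forces \<open>\<parallel>z\<^sub>k - x\<^sup>*\<parallel>\<^sup>2 / 2 + A\<^sub>k \<epsilon> < R\<^sup>2 / 2\<close>.  This keeps the next
  points in the ball, and together with \<open>A\<^sub>k \<ge> (k + 2)\<^sup>2 / (4 L)\<close> it bounds \<open>k\<close>.
\<close>

section \<open>Convex combinations, the descent lemma and projections\<close>

lemma convex_combination_mem:
  fixes x z :: "'a::real_vector"
  assumes "convex S" "x \<in> S" "z \<in> S" "0 \<le> s" "0 \<le> t" "0 < s + t"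
  shows "(s *\<^sub>R x + t *\<^sub>R z) /\<^sub>R (s + t) \<in> S"
proof -
  have "(s / (s + t)) *\<^sub>R x + (t / (s + t)) *\<^sub>R z \<in> S"
    using assms by (intro convexD) (simp_all add: add_divide_distrib[symmetric])
  then show ?thesis
    by (simp add: scaleR_add_right divide_inverse_commute)
qed

lemma convex_combination_close:
  fixes a x z :: "'a::real_normed_vector"
  assumes "norm (x - a) \<le> R" "norm (z - a) \<le> R" "0 \<le> s" "0 \<le> t" "0 < s + t"
  shows "norm ((s *\<^sub>R x + t *\<^sub>R z) /\<^sub>R (s + t) - a) \<le> R"
  using convex_combination_mem[OF convex_cball, of x a R z s t] assms
  by (simp add: dist_norm norm_minus_commute)

text \<open>Along the segment, \<open>\<phi>\<close> is \<open>f\<close> minus its linear part and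
  the quadratic term. The Lipschitz bound makes \<open>\<phi>'\<close> nonpositive in the forward
  direction at interior times, so the mean value theorem gives
  \<open>\<phi> 1 \<le> \<phi> 0\<close>.\<close>

lemma descent_lemma:
  fixes f :: "real^'n \<Rightarrow> real"
  assumes "convex Q" "has_gradient_on f grad Q" "L_smooth_on M grad Q" "x \<in> Q" "y \<in> Q"
  shows "f y \<le> f x + grad x \<bullet> (y - x) + M / 2 * (norm (y - x))\<^sup>2"
proof -
  define d where "d = y - x"
  define p where "p t = x + t *\<^sub>R d" for t
  define \<phi> where "\<phi> t = f (p t) - t * (grad x \<bullet> d) - M / 2 * t\<^sup>2 * (norm d)\<^sup>2" for t
  define \<phi>' where
    "\<phi>' t h = h * (grad (p t) \<bullet> d) - h * (grad x \<bullet> d) - M * t * h * (norm d)\<^sup>2" for t h :: real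
  have pQ: "p t \<in> Q" if "0 \<le> t" "t \<le> 1" for t
    using convexD_alt[OF assms(1,4,5), of t] that
    by (simp add: p_def d_def algebra_simps)
  have "(\<phi> has_derivative \<phi>' t) (at t within {0..1})" if "0 \<le> t" "t \<le> 1" for t
  proof -
    have "(p has_derivative (\<lambda>h. h *\<^sub>R d)) (at t within {0..1})"
      unfolding p_def by (auto intro!: derivative_eq_intros)
    \<comment> \<open>The gradient exists only relative to \<open>Q\<close>, so the chain rule is
      applied within the image of the segment, which lies in \<open>Q\<close>.\<close>
    moreover have "(f has_derivative (\<lambda>h. grad (p t) \<bullet> h)) (at (p t) within p ` {0..1})"
    proof (rule has_derivative_subset)
      show "(f has_derivative (\<lambda>h. grad (p t) \<bullet> h)) (at (p t) within Q)"
        using assms(2) pQ[OF that] unfolding has_gradient_on_def by blast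
      show "p ` {0..1} \<subseteq> Q"
        using pQ by auto
    qed
    ultimately have "((\<lambda>t. f (p t)) has_derivative (\<lambda>h. grad (p t) \<bullet> (h *\<^sub>R d))) (at t within {0..1})"
      by (rule has_derivative_in_compose)
    moreover have "((\<lambda>t. t * (grad x \<bullet> d) + M / 2 * t\<^sup>2 * (norm d)\<^sup>2) has_derivative
        (\<lambda>h. h * (grad x \<bullet> d) + M * t * h * (norm d)\<^sup>2)) (at t within {0..1})"
      by (auto intro!: derivative_eq_intros simp: fun_eq_iff)
    ultimately have "((\<lambda>t. f (p t) - (t * (grad x \<bullet> d) + M / 2 * t\<^sup>2 * (norm d)\<^sup>2)) has_derivative
        (\<lambda>h. grad (p t) \<bullet> (h *\<^sub>R d) - (h * (grad x \<bullet> d) + M * t * h * (norm d)\<^sup>2)))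
        (at t within {0..1})"
      by (rule has_derivative_diff)
    then show ?thesis
      by (simp add: \<phi>_def[abs_def] \<phi>'_def[abs_def] diff_diff_eq)
  qed
  then obtain t where t: "0 < t" "t < 1" and eq: "\<phi> 1 - \<phi> 0 = \<phi>' t (1 - 0)"
    using mvt_simple[of 0 1 \<phi> \<phi>'] by auto
  have "(grad (p t) - grad x) \<bullet> d \<le> norm (grad (p t) - grad x) * norm d"
    by (rule norm_cauchy_schwarz)
  also have "\<dots> \<le> (M * norm (p t - x)) * norm d"
    using assms(3,4) pQ[of t] t unfolding L_smooth_on_def by (intro mult_right_mono) auto
  also have "\<dots> = M * t * (norm d)\<^sup>2"
    using t by (simp add: p_def power2_eq_square)
  finally show ?thesis
    using eq by (simp add: \<phi>_def \<phi>'_def p_def d_def inner_diff_left)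
qed

text \<open>Up to a constant, \<open>q\<close> is half the squared distance to \<open>a\<close>, so
  its minimizer is the projection of \<open>a\<close> onto \<open>Q\<close>. The obtuse-angle
  inequality of projections then yields the additional quadratic gain.\<close>

lemma arg_min_on_quadratic:
  fixes q :: "'a::euclidean_space \<Rightarrow> real"
  assumes "closed Q" "convex Q" "Q \<noteq> {}"
    and q: "\<And>x. q x = 1 / 2 * (norm (x - a))\<^sup>2 + b"
  shows "arg_min_on q Q \<in> Q"
    and "u \<in> Q \<Longrightarrow> q (arg_min_on q Q) + 1 / 2 * (norm (u - arg_min_on q Q))\<^sup>2 \<le> q u"
proof -
  have q_le: "q x \<le> q y \<longleftrightarrow> dist a x \<le> dist a y" for x y
    by (simp add: q dist_norm norm_minus_commute)
  define z where "z = arg_min_on q Q"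
  have "is_arg_min q (\<lambda>x. x \<in> Q) (closest_point Q a)"
    using closest_point_exists[OF assms(1,3), of a] by (simp add: is_arg_min_linorder q_le)
  \<comment> \<open>\<open>closest_point\<close> serves only as a witness of existence; the
    minimality passes to whatever point the choice operator picks.\<close>
  then have "is_arg_min q (\<lambda>x. x \<in> Q) z"
    unfolding z_def arg_min_on_def arg_min_def by (rule someI)
  then have zQ: "z \<in> Q" and min: "\<And>x. x \<in> Q \<Longrightarrow> dist a z \<le> dist a x"
    by (auto simp: is_arg_min_linorder q_le)
  show "arg_min_on q Q \<in> Q"
    using zQ by (simp add: z_def)
  assume u: "u \<in> Q"
  have "(a - z) \<bullet> (u - z) \<le> 0"
    using any_closest_point_dot[OF assms(2,1) zQ u] min by blast
  then have "q z + 1 / 2 * (norm (u - z))\<^sup>2 \<le> q u"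
    unfolding q power2_norm_eq_inner by (simp add: algebra_simps inner_commute)
  then show "q (arg_min_on q Q) + 1 / 2 * (norm (u - arg_min_on q Q))\<^sup>2 \<le> q u"
    by (simp add: z_def)
qed

section \<open>The weights \<alpha> and A\<close>

lemma stm_pos:
  assumes "L > 0"
  shows stm_\<alpha>_pos: "stm_\<alpha> L k > 0" and stm_A_pos: "stm_A L k > 0"
proof (induction k)
  case 0
  { case 1 show ?case using assms by simp }
  { case 2 show ?case using assms by simp }
next
  case (Suc k)
  have "0 < stm_\<alpha> L (Suc k)"
    using assms Suc by (auto intro!: add_pos_nonneg)
  then show "0 < stm_\<alpha> L (Suc k)" "0 < stm_A L (Suc k)"
    using Suc by simp_all
qed

text \<open>Each later \<alpha> is the positive root of the quadratic equation behind the method.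
  This identity is what lets the quadratic terms match exactly in
  \<open>estimate_step\<close>.\<close>

lemma stm_A_eq_\<alpha>:
  assumes "L > 0"
  shows "stm_A L k = L * (stm_\<alpha> L k)\<^sup>2"
proof (cases k)
  case 0
  then show ?thesis using assms by (simp add: power2_eq_square)
next
  case (Suc m)
  define s where "s = sqrt (1 / (4 * L\<^sup>2) + stm_A L m / L)"
  have "s\<^sup>2 = 1 / (4 * L\<^sup>2) + stm_A L m / L"
    using assms stm_A_pos[OF assms, of m] by (simp add: s_def)
  then have "L * (1 / (2 * L) + s)\<^sup>2 = stm_A L m + (1 / (2 * L) + s)"
    using assms by (simp add: power2_sum field_simps power2_eq_square)
  then show ?thesis
    by (simp add: Suc s_def)
qed

text \<open>The bound on \<open>stm_A L k\<close> makes the square root at least (k + 2) / (2 L);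
  the extra 1 / (2 L) in \<alpha> advances this to (k + 3) / (2 L), and squaring closes the
  induction. Equality holds at 0.\<close>

lemma stm_A_lower_bound:
  assumes "L > 0"
  shows "(real k + 2)\<^sup>2 / (4 * L) \<le> stm_A L k"
proof (induction k)
  case 0
  then show ?case using assms by simp
next
  case (Suc k)
  have "((real k + 2) / (2 * L))\<^sup>2 \<le> stm_A L k / L"
    using divide_right_mono[OF Suc, of L] assms by (simp add: power2_eq_square mult.assoc)
  also have "\<dots> \<le> 1 / (4 * L\<^sup>2) + stm_A L k / L"
    by simp
  finally have "(real k + 2) / (2 * L) \<le> sqrt (1 / (4 * L\<^sup>2) + stm_A L k / L)"
    by (rule real_le_rsqrt)
  then have "(real k + 3) / (2 * L) \<le> stm_\<alpha> L (Suc k)"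
    by (simp add: add_divide_distrib)
  then have "L * ((real k + 3) / (2 * L))\<^sup>2 \<le> stm_A L (Suc k)"
    unfolding stm_A_eq_\<alpha>[OF assms] using assms
    by (intro mult_left_mono power_mono) auto
  then show ?case
    using assms by (simp add: power2_eq_square add.commute del: stm_\<alpha>.simps stm_A.simps)
qed

lemma sum_stm_\<alpha>: "(\<Sum>j\<le>k. stm_\<alpha> L j) = stm_A L k"
  by (induction k) simp_all

declare stm_z.simps [simp del]

section \<open>The inexact first-order model of \<open>f\<close>\<close>

locale stm =
  fixes Q :: "(real^'n) set"
    and f :: "real^'n \<Rightarrow> real"
    and grad g :: "real^'n \<Rightarrow> real^'n"
    and L_f L \<delta> :: real
    and x_start :: "real^'n"
  assumes Q_closed: "closed Q" and Q_convex: "convex Q"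
    and gradient: "has_gradient_on f grad Q"
    and L_f_pos: "L_f > 0" and smooth: "L_smooth_on L_f grad Q"
    and first_order_convex: "first_order_convex_on f grad Q"
    and inexact: "x \<in> Q \<Longrightarrow> norm (g x - grad x) \<le> \<delta>"
    and L_eq: "L = 2 * L_f"
    and x_start_mem: "x_start \<in> Q"
begin

abbreviation "\<alpha> \<equiv> stm_\<alpha> L"
abbreviation "A \<equiv> stm_A L"
abbreviation "x \<equiv> stm_x Q f g L x_start"
abbreviation "y \<equiv> stm_y Q f g L x_start"
abbreviation "z \<equiv> stm_z Q f g L x_start"
abbreviation "\<psi> \<equiv> stm_\<psi> Q f g L x_start"

lemma L_pos: "L > 0"
  using L_f_pos L_eq by simp

lemmas \<alpha>_pos = stm_\<alpha>_pos[OF L_pos] and A_pos = stm_A_pos[OF L_pos]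
  and A_eq_\<alpha> = stm_A_eq_\<alpha>[OF L_pos]

lemma \<delta>_nonneg: "0 \<le> \<delta>"
  using inexact[OF x_start_mem] norm_ge_zero[of "g x_start - grad x_start"] by linarith

lemma gradient_error:
  assumes "u \<in> Q"
  shows "\<bar>(grad u - g u) \<bullet> v\<bar> \<le> \<delta> * norm v"
proof -
  have "\<bar>(grad u - g u) \<bullet> v\<bar> \<le> norm (grad u - g u) * norm v"
    by (rule Cauchy_Schwarz_ineq2)
  also have "\<dots> \<le> \<delta> * norm v"
    using inexact[OF assms] by (intro mult_right_mono) (simp_all add: norm_minus_commute)
  finally show ?thesis .
qed

lemma inexact_lower:
  assumes "u \<in> Q" "v \<in> Q"
  shows "f u + g u \<bullet> (v - u) \<le> f v + \<delta> * norm (v - u)"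
proof -
  have "f u + grad u \<bullet> (v - u) \<le> f v"
    using first_order_convex assms by (simp add: first_order_convex_on_def)
  then show ?thesis
    using gradient_error[OF assms(1), of "v - u"] by (simp add: inner_diff_left)
qed

text \<open>Since \<open>L\<close> is twice \<open>L_f\<close>, half of the quadratic term is to
  spare. By Young's inequality it absorbs the linear error \<open>\<delta> * norm (v - u)\<close> at
  the fixed cost \<open>\<delta>\<^sup>2 / L\<close>.\<close>

lemma inexact_upper:
  assumes "u \<in> Q" "v \<in> Q"
  shows "f v \<le> f u + g u \<bullet> (v - u) + L / 2 * (norm (v - u))\<^sup>2 + \<delta>\<^sup>2 / L"
proof -
  have "f v \<le> f u + grad u \<bullet> (v - u) + L_f / 2 * (norm (v - u))\<^sup>2"
    by (rule descent_lemma[OF Q_convex gradient smooth assms])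
  also have "grad u \<bullet> (v - u) \<le> g u \<bullet> (v - u) + \<delta> * norm (v - u)"
    using gradient_error[OF assms(1), of "v - u"] by (simp add: inner_diff_left)
  also have "\<delta> * norm (v - u) \<le> \<delta>\<^sup>2 / L + L_f / 2 * (norm (v - u))\<^sup>2"
  proof -
    have "0 \<le> (\<delta> - L_f * norm (v - u))\<^sup>2 / (2 * L_f)"
      using L_f_pos by simp
    also have "\<dots> = \<delta>\<^sup>2 / L + L_f / 2 * (norm (v - u))\<^sup>2 - \<delta> * norm (v - u)"
      using L_f_pos by (simp add: L_eq power2_diff field_simps power2_eq_square)
    finally show ?thesis by simp
  qed
  finally show ?thesis
    by (simp add: L_eq)
qed

section \<open>Estimating functions, feasibility and two-sided estimates\<close>

lemma \<psi>_quadratic: "\<exists>a b. \<forall>u. \<psi> k u = 1 / 2 * (norm (u - a))\<^sup>2 + b"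
proof (induction k)
  have add_affine: "\<exists>a b. \<forall>u. 1 / 2 * (norm (u - a0))\<^sup>2 + b0 + c * (d + e \<bullet> (u - w))
      = 1 / 2 * (norm (u - a))\<^sup>2 + b" for a0 e w :: "real^'n" and b0 c d
  proof (intro exI allI)
    fix u
    \<comment> \<open>Completing the square: an affine term with slope \<open>c *\<^sub>R e\<close>
      moves the centre by its negative and leaves the leading coefficient 1/2 unchanged.\<close>
    show "1 / 2 * (norm (u - a0))\<^sup>2 + b0 + c * (d + e \<bullet> (u - w))
      = 1 / 2 * (norm (u - (a0 - c *\<^sub>R e)))\<^sup>2
        + (b0 + c * (d + e \<bullet> (a0 - w)) - 1 / 2 * (norm (c *\<^sub>R e))\<^sup>2)"
      unfolding power2_norm_eq_inner by (simp add: algebra_simps inner_commute)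
  qed
  {
    case 0
    show ?case
      using add_affine[of x_start 0 "\<alpha> 0" "f x_start" "g x_start" x_start] by simp
  next
    case (Suc k)
    then obtain a b where "\<And>u. \<psi> k u = 1 / 2 * (norm (u - a))\<^sup>2 + b"
      by blast
    then show ?case
      using add_affine[of a b "\<alpha> (Suc k)" "f (y (Suc k))" "g (y (Suc k))" "y (Suc k)"]
      by simp
  }
qed

lemma z_mem: "z k \<in> Q"
  and z_minimizes: "u \<in> Q \<Longrightarrow> \<psi> k (z k) + 1 / 2 * (norm (u - z k))\<^sup>2 \<le> \<psi> k u"
proof -
  obtain a b where *: "\<And>u. \<psi> k u = 1 / 2 * (norm (u - a))\<^sup>2 + b"
    using \<psi>_quadratic by blast
  have "Q \<noteq> {}"
    using x_start_mem by blast
  note min = arg_min_on_quadratic[OF Q_closed Q_convex this *, folded stm_z.simps]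
  show "z k \<in> Q" "u \<in> Q \<Longrightarrow> \<psi> k (z k) + 1 / 2 * (norm (u - z k))\<^sup>2 \<le> \<psi> k u"
    using min by blast+
qed

lemma A_nonneg: "0 \<le> A k" and \<alpha>_nonneg: "0 \<le> \<alpha> k"
  using A_pos[of k] \<alpha>_pos[of k] by simp_all

lemma A_Suc_pos: "0 < A k + \<alpha> (Suc k)"
  using A_pos \<alpha>_pos by (rule add_pos_pos)

lemma x_mem: "x k \<in> Q"
proof (induction k)
  case (Suc k)
  then show ?case
    unfolding stm_x.simps stm_A.simps
    by (intro convex_combination_mem Q_convex z_mem A_nonneg \<alpha>_nonneg A_Suc_pos)
qed (simp add: z_mem)

lemma y_mem: "y k \<in> Q"
proof (cases k)
  case (Suc m)
  then show ?thesis
    unfolding Suc stm_y.simps stm_A.simps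
    by (intro convex_combination_mem Q_convex x_mem z_mem A_nonneg \<alpha>_nonneg A_Suc_pos)
qed (simp add: x_start_mem)

text \<open>The descent inequality from y to the new x is combined with convexity between y and the
  old x. The new x and y differ only in which z they average, so the descent term becomes a multiple
  of the squared step of z.\<close>

lemma estimate_step:
  "A (Suc k) * f (x (Suc k)) \<le> A k * f (x k)
     + \<alpha> (Suc k) * (f (y (Suc k)) + g (y (Suc k)) \<bullet> (z (Suc k) - y (Suc k)))
     + 1 / 2 * (norm (z (Suc k) - z k))\<^sup>2 + A (Suc k) * (\<delta>\<^sup>2 / L)
     + \<delta> * (\<alpha> (Suc k) * norm (y (Suc k) - z k))"
proof -
  define a B B' u u' v v' w where defs: "a = \<alpha> (Suc k)" "B = A k" "B' = A (Suc k)"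
    "u = x k" "u' = x (Suc k)" "v = z k" "v' = z (Suc k)" "w = y (Suc k)"
  have a: "a > 0" and B': "B' > 0" "B' = B + a" "B' = L * a\<^sup>2"
    unfolding defs by (rule \<alpha>_pos A_pos stm_A.simps(2) A_eq_\<alpha>)+
  have u': "B' *\<^sub>R u' = B *\<^sub>R u + a *\<^sub>R v'" and w: "B' *\<^sub>R w = B *\<^sub>R u + a *\<^sub>R v"
    using B'(1) unfolding defs stm_x.simps stm_y.simps by (simp_all del: stm_\<alpha>.simps stm_A.simps)
  have "B' *\<^sub>R (u' - w) = a *\<^sub>R (v' - v)"
    using u' w by (simp add: scaleR_diff_right)
  then have "norm (B' *\<^sub>R (u' - w)) = norm (a *\<^sub>R (v' - v))"
    by simp
  then have "B' * norm (u' - w) = a * norm (v' - v)"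
    using a B' by simp
  then have steps: "norm (v' - v) = L * a * norm (u' - w)"
    using a unfolding B'(3) by (simp add: power2_eq_square)
  \<comment> \<open>Here \<open>B' = L * a\<^sup>2\<close> makes the coefficient exactly 1/2, the
    strong convexity constant of \<open>\<psi> k\<close>.\<close>
  have quad: "B' * (L / 2 * (norm (u' - w))\<^sup>2) = 1 / 2 * (norm (v' - v))\<^sup>2"
    unfolding B'(3) steps by (simp add: power2_eq_square)
  have *: "B *\<^sub>R (u - w) = a *\<^sub>R (w - v)"
    using w unfolding B'(2) by (simp add: algebra_simps)
  have "B *\<^sub>R (u - w) + a *\<^sub>R (v' - w) = B' *\<^sub>R (u' - w)"
    using u' unfolding B'(2) by (simp add: algebra_simps)
  then have lin: "B' * (g w \<bullet> (u' - w)) = B * (g w \<bullet> (u - w)) + a * (g w \<bullet> (v' - w))"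
    by (metis inner_add_right inner_scaleR_right)
  \<comment> \<open>Moving the gradient error from \<open>u - w\<close> to \<open>w - v\<close>
    replaces the weight \<open>B\<close> by \<open>a\<close>. The accumulated errors then carry
    weights \<alpha>, whose sum is only A.\<close>
  have "B * ((grad w - g w) \<bullet> (u - w)) = a * ((grad w - g w) \<bullet> (w - v))"
    using * by (metis inner_scaleR_right)
  moreover have "a * ((grad w - g w) \<bullet> (w - v)) \<ge> a * (- (\<delta> * norm (w - v)))"
    using gradient_error[of w "w - v"] y_mem a
    by (intro mult_left_mono) (auto simp: defs abs_le_iff simp del: stm_y.simps)
  ultimately have err: "B * ((grad w - g w) \<bullet> (u - w)) \<ge> - (\<delta> * (a * norm (w - v)))"
    by (simp add: algebra_simps)
  have "f w + grad w \<bullet> (u - w) \<le> f u"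
    using first_order_convex x_mem y_mem unfolding defs first_order_convex_on_def by blast
  then have "B * (f w + grad w \<bullet> (u - w)) \<le> B * f u"
    unfolding defs by (intro mult_left_mono A_nonneg)
  then have cvx: "B * f w + B * (g w \<bullet> (u - w)) \<le> B * f u + \<delta> * (a * norm (w - v))"
    using err by (simp add: algebra_simps)
  have "B' * f u' \<le> B' * (f w + g w \<bullet> (u' - w) + L / 2 * (norm (u' - w))\<^sup>2 + \<delta>\<^sup>2 / L)"
    unfolding defs by (intro mult_left_mono inexact_upper y_mem x_mem A_nonneg)
  also have "\<dots> = B * f w + a * f w + B' * (g w \<bullet> (u' - w))
      + B' * (L / 2 * (norm (u' - w))\<^sup>2) + B' * (\<delta>\<^sup>2 / L)"
    unfolding distrib_left[of B'] using B'(2) by (simp add: distrib_right)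
  also have "\<dots> \<le> B * f u + a * (f w + g w \<bullet> (v' - w)) + 1 / 2 * (norm (v' - v))\<^sup>2
      + B' * (\<delta>\<^sup>2 / L) + \<delta> * (a * norm (w - v))"
    unfolding lin quad using cvx by (simp add: distrib_left)
  finally show ?thesis
    unfolding defs .
qed

text \<open>The squared step of z in \<open>estimate_step\<close> is paid for by the growth of
  \<open>\<psi> k\<close> away from its minimizer \<open>z k\<close>.\<close>

lemma estimate_lower:
  "A k * f (x k) \<le> \<psi> k (z k) + \<delta>\<^sup>2 / L * (\<Sum>j\<le>k. A j)
     + \<delta> * (\<Sum>j<k. \<alpha> (Suc j) * norm (y (Suc j) - z j))"
proof (induction k)
  case 0
  \<comment> \<open>Scaling by \<open>A 0 = 1 / L\<close> turns the smoothness term into the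
    proximal term of \<open>\<psi> 0\<close>.\<close>
  have "1 / L * f (z 0) \<le> 1 / L * (f x_start + g x_start \<bullet> (z 0 - x_start)
      + L / 2 * (norm (z 0 - x_start))\<^sup>2 + \<delta>\<^sup>2 / L)"
    using inexact_upper[OF x_start_mem z_mem] L_pos by (intro mult_left_mono) simp_all
  then show ?case
    using L_pos by (simp add: distrib_left)
next
  case (Suc k)
  have "\<psi> k (z k) + 1 / 2 * (norm (z (Suc k) - z k))\<^sup>2 \<le> \<psi> k (z (Suc k))"
    by (rule z_minimizes[OF z_mem])
  then show ?case
    using Suc estimate_step[of k]
    by (simp add: distrib_left mult.commute del: stm_\<alpha>.simps stm_A.simps stm_x.simps stm_y.simps)
qed

text \<open>Each inexact linearization lies below \<open>f\<close> up to an error linear in the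
  distance, and the weights add up to \<open>A k\<close>.\<close>

lemma estimate_upper:
  assumes "u \<in> Q"
  shows "\<psi> k u \<le> 1 / 2 * (norm (u - x_start))\<^sup>2 + A k * f u
    + \<delta> * (\<Sum>j\<le>k. \<alpha> j * norm (u - y j))"
proof (induction k)
  have lin: "\<alpha> j * (f (y j) + g (y j) \<bullet> (u - y j)) \<le> \<alpha> j * f u + \<delta> * (\<alpha> j * norm (u - y j))" for j
    using mult_left_mono[OF inexact_lower[OF y_mem assms] \<alpha>_nonneg, of j j]
    by (simp add: algebra_simps)
  {
    case 0
    then show ?case using lin[of 0] by simp
  next
    case (Suc k)
    then show ?case
      using lin[of "Suc k"] by (simp add: distrib_left distrib_right del: stm_\<alpha>.simps stm_y.simps)
  }
qed

section \<open>Confinement to the ball and the stopping time\<close>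

lemma y_Suc_close:
  assumes "norm (x k - c) \<le> R" "norm (z k - c) \<le> R"
  shows "norm (y (Suc k) - c) \<le> R"
  unfolding stm_y.simps stm_A.simps
  by (intro convex_combination_close assms A_nonneg \<alpha>_nonneg A_Suc_pos)

lemma x_Suc_close:
  assumes "norm (x k - c) \<le> R" "norm (z (Suc k) - c) \<le> R"
  shows "norm (x (Suc k) - c) \<le> R"
  unfolding stm_x.simps stm_A.simps
  by (intro convex_combination_close assms A_nonneg \<alpha>_nonneg A_Suc_pos)

text \<open>The factor 3 is 1 for the distances from y to \<open>u\<close> plus 2 for those from y
  to the preceding z. Closeness of z is assumed only before \<open>k\<close>, so the conclusion can
  be used to bound \<open>z k\<close> itself.\<close>

lemma convergence_estimate:
  assumes "u \<in> Q" and y: "\<And>j. j \<le> k \<Longrightarrow> norm (y j - u) \<le> R"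
    and z: "\<And>j. j < k \<Longrightarrow> norm (z j - u) \<le> R"
  shows "A k * (f (x k) - f u) + 1 / 2 * (norm (z k - u))\<^sup>2
    \<le> 1 / 2 * R\<^sup>2 + \<delta>\<^sup>2 / L * (\<Sum>j\<le>k. A j) + 3 * R * \<delta> * A k"
proof -
  have y0: "norm (x_start - u) \<le> R"
    using y[of 0] by simp
  then have R: "0 \<le> R"
    using norm_ge_zero order_trans by blast
  have "(\<Sum>j\<le>k. \<alpha> j * norm (u - y j)) \<le> (\<Sum>j\<le>k. \<alpha> j * R)"
    using y \<alpha>_nonneg by (intro sum_mono mult_left_mono) (auto simp: norm_minus_commute)
  then have sum1: "(\<Sum>j\<le>k. \<alpha> j * norm (u - y j)) \<le> R * A k"
    unfolding sum_distrib_right[symmetric] sum_stm_\<alpha> by (simp add: mult.commute)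
  have "(\<Sum>j<k. \<alpha> (Suc j) * norm (y (Suc j) - z j)) \<le> (\<Sum>j<k. \<alpha> (Suc j) * (2 * R))"
  proof (intro sum_mono mult_left_mono \<alpha>_nonneg)
    fix j assume "j \<in> {..<k}"
    then show "norm (y (Suc j) - z j) \<le> 2 * R"
      using y[of "Suc j"] z[of j] norm_triangle_ineq4[of "y (Suc j) - u" "z j - u"]
      by (simp del: stm_y.simps)
  qed
  also have "\<dots> = (\<Sum>j<k. \<alpha> (Suc j)) * (2 * R)"
    by (simp add: sum_distrib_right)
  also have "\<dots> \<le> A k * (2 * R)"
  proof (intro mult_right_mono)
    have "A k = \<alpha> 0 + (\<Sum>j<k. \<alpha> (Suc j))"
      unfolding sum_stm_\<alpha>[symmetric] by (rule sum.atMost_shift)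
    then show "(\<Sum>j<k. \<alpha> (Suc j)) \<le> A k"
      using \<alpha>_nonneg[of 0] by simp
  qed (use R in simp)
  finally have sum2: "(\<Sum>j<k. \<alpha> (Suc j) * norm (y (Suc j) - z j)) \<le> 2 * R * A k"
    by (simp add: mult.commute)
  have errs: "\<delta> * (\<Sum>j\<le>k. \<alpha> j * norm (u - y j))
      + \<delta> * (\<Sum>j<k. \<alpha> (Suc j) * norm (y (Suc j) - z j)) \<le> 3 * R * \<delta> * A k"
    using mult_left_mono[OF sum1 \<delta>_nonneg] mult_left_mono[OF sum2 \<delta>_nonneg]
    by (simp add: algebra_simps)
  have "(norm (u - x_start))\<^sup>2 \<le> R\<^sup>2"
    using y0 by (intro power_mono) (simp_all add: norm_minus_commute)
  then show ?thesis
    using estimate_lower[of k] z_minimizes[OF assms(1), of k] estimate_upper[OF assms(1), of k] errs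
    by (simp add: right_diff_distrib norm_minus_commute)
qed

lemma stm_R_le:
  assumes "\<And>j. j \<le> k \<Longrightarrow> norm (z j - c) \<le> R" "\<And>j. j \<le> k \<Longrightarrow> norm (x j - c) \<le> R"
    "\<And>j. j \<le> k \<Longrightarrow> norm (y j - c) \<le> R"
  shows "stm_R Q f g L x_start c k \<le> R"
  unfolding stm_R_def using assms by (subst Max_le_iff) auto

text \<open>Strong induction in the order in which the points are computed: y from the preceding x
  and z, then z from the convergence estimate, then x from the preceding x and the new z.\<close>

lemma before_stopping:
  assumes "u \<in> Q" "norm (x_start - u) \<le> R" "0 < \<epsilon>"
    and run: "\<And>j. j \<le> k \<Longrightarrow>
      \<delta>\<^sup>2 / L / A j * (\<Sum>i=0..j. A i) + 3 * R * \<delta> + \<epsilon> < f (x j) - f u"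
  shows "norm (z k - u) \<le> R \<and> norm (x k - u) \<le> R \<and> norm (y k - u) \<le> R \<and>
    A k * \<epsilon> < R\<^sup>2 / 2"
  using run
proof (induction k rule: less_induct)
  case (less k)
  have R: "0 \<le> R"
    using assms(2) norm_ge_zero order_trans by blast
  have IH: "norm (z j - u) \<le> R \<and> norm (x j - u) \<le> R \<and> norm (y j - u) \<le> R" if "j < k" for j
    using less that by simp
  have y_k: "norm (y k - u) \<le> R"
  proof (cases k)
    case 0
    then show ?thesis using assms(2) by simp
  next
    case (Suc m)
    then show ?thesis using IH[of m] y_Suc_close[of m u R] by blast
  qed
  have "A k * (f (x k) - f u) + 1 / 2 * (norm (z k - u))\<^sup>2
      \<le> 1 / 2 * R\<^sup>2 + \<delta>\<^sup>2 / L * (\<Sum>j\<le>k. A j) + 3 * R * \<delta> * A k"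
    using IH y_k by (intro convergence_estimate assms(1)) (auto simp: le_less)
  \<comment> \<open>Multiplied by \<open>A k\<close>, the error terms of the failed test cancel
    those of the estimate, leaving the gain \<open>A k * \<epsilon>\<close>.\<close>
  moreover have "A k * (\<delta>\<^sup>2 / L / A k * (\<Sum>i\<le>k. A i) + 3 * R * \<delta> + \<epsilon>) < A k * (f (x k) - f u)"
    using less.prems[of k] A_pos[of k] unfolding atLeast0AtMost by simp
  moreover have "A k * (\<delta>\<^sup>2 / L / A k * (\<Sum>i\<le>k. A i) + 3 * R * \<delta> + \<epsilon>)
      = \<delta>\<^sup>2 / L * (\<Sum>i\<le>k. A i) + 3 * R * \<delta> * A k + A k * \<epsilon>"
    using A_pos[of k] by (simp add: distrib_left)
  ultimately have gap: "(norm (z k - u))\<^sup>2 / 2 + A k * \<epsilon> < R\<^sup>2 / 2"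
    by simp
  moreover have "0 < A k * \<epsilon>"
    using A_pos assms(3) by simp
  ultimately have z_k: "norm (z k - u) \<le> R"
    using R by (intro power2_le_imp_le[of "norm (z k - u)" R]) linarith+
  have x_k: "norm (x k - u) \<le> R"
  proof (cases k)
    case 0
    then show ?thesis using z_k by simp
  next
    case (Suc m)
    then show ?thesis using IH[of m] z_k x_Suc_close[of m u R] by blast
  qed
  have "A k * \<epsilon> < R\<^sup>2 / 2"
    using gap zero_le_power2[of "norm (z k - u)"] by linarith
  then show ?case
    using z_k x_k y_k by simp
qed

lemma before_stopping_index:
  assumes "0 < \<epsilon>" "A k * \<epsilon> < R\<^sup>2 / 2"
  shows "real k + 2 < sqrt (2 * L * R\<^sup>2 / \<epsilon>)"
proof -
  have "(real k + 2)\<^sup>2 / (4 * L) * \<epsilon> \<le> A k * \<epsilon>"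
    using stm_A_lower_bound[OF L_pos] assms(1) by (intro mult_right_mono) simp_all
  also note assms(2)
  finally have "(real k + 2)\<^sup>2 < 2 * L * R\<^sup>2 / \<epsilon>"
    using L_pos assms(1) by (simp add: field_simps)
  then show ?thesis
    by (rule real_less_rsqrt)
qed

end

theorem theorem4p8:
  fixes Q :: "(real^'n) set"
    and f :: "real^'n \<Rightarrow> real"
    and grad g :: "real^'n \<Rightarrow> real^'n"
    and L_f L \<delta> \<delta>1 \<delta>2 R \<epsilon> :: real
    and x_start xs :: "real^'n"
  assumes "closed Q" and "convex Q"
    and "has_gradient_on f grad Q"
    and "L_f > 0" and "L_smooth_on L_f grad Q"
    and "first_order_convex_on f grad Q"
    and "\<forall>x\<in>Q. norm (g x - grad x) \<le> \<delta>"
    and "L = 2 * L_f" and "\<delta>1 = \<delta>" and "\<delta>2 = \<delta>\<^sup>2 / L"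
    and "x_start \<in> Q"
    and "closest_solution f Q x_start xs"
    and "norm (stm_y Q f g L x_start 0 - xs) \<le> R"
    and "\<epsilon> > 0"
  shows "\<exists>N. first_index (\<lambda>k. f (stm_x Q f g L x_start k) - f xs
                 \<le> \<delta>2 / stm_A L k * (\<Sum>j=0..k. stm_A L j) + 3 * R * \<delta>1 + \<epsilon>) N
           \<and> (\<forall>k<N. stm_R Q f g L x_start xs k \<le> R)
           \<and> int N \<le> \<lceil>sqrt (2 * L * R\<^sup>2 / \<epsilon>)\<rceil>"
proof -
  interpret stm Q f grad g L_f L \<delta> x_start
    using assms by unfold_locales auto
  have xs: "xs \<in> Q"
    using assms(12) by (simp add: closest_solution_def solution_def is_arg_min_def)
  have start: "norm (x_start - xs) \<le> R"
    using assms(13) by simp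
  define P where "P = (\<lambda>k. f (x k) - f xs
    \<le> \<delta>2 / A k * (\<Sum>j=0..k. A j) + 3 * R * \<delta>1 + \<epsilon>)"
  have run: "norm (z k - xs) \<le> R \<and> norm (x k - xs) \<le> R \<and> norm (y k - xs) \<le> R \<and>
      A k * \<epsilon> < R\<^sup>2 / 2" if "\<forall>j\<le>k. \<not> P j" for k
    using that by (intro before_stopping xs start assms(14))
      (auto simp: P_def assms(9,10) not_le)
  have index: "real k + 2 < sqrt (2 * L * R\<^sup>2 / \<epsilon>)" if "\<forall>j\<le>k. \<not> P j" for k
    using run[OF that] by (intro before_stopping_index assms(14)) simp
  have "\<exists>k. P k"
  proof (rule ccontr)
    assume "\<nexists>k. P k"
    \<comment> \<open>A test that never succeeds would bound all natural numbers by one fixed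
      real.\<close>
    then have "real k + 2 < sqrt (2 * L * R\<^sup>2 / \<epsilon>)" for k
      using index by simp
    moreover obtain k :: nat where "sqrt (2 * L * R\<^sup>2 / \<epsilon>) < real k"
      using reals_Archimedean2 by blast
    ultimately show False
      by (smt (verit))
  qed
  define N where "N = (LEAST k. P k)"
  have N: "P N" "\<And>m. m < N \<Longrightarrow> \<not> P m"
    using \<open>\<exists>k. P k\<close> by (auto simp: N_def intro: LeastI_ex dest: not_less_Least)
  have "first_index P N"
    using N by (simp add: first_index_def)
  moreover have "stm_R Q f g L x_start xs k \<le> R" if "k < N" for k
  proof -
    have "norm (z j - xs) \<le> R \<and> norm (x j - xs) \<le> R \<and> norm (y j - xs) \<le> R" if "j \<le> k" for j
      using run[of j] N(2) \<open>k < N\<close> that by simp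
    then show ?thesis
      by (intro stm_R_le) blast+
  qed
  moreover have "int N \<le> \<lceil>sqrt (2 * L * R\<^sup>2 / \<epsilon>)\<rceil>"
  proof -
    have "real N \<le> sqrt (2 * L * R\<^sup>2 / \<epsilon>)"
    proof (cases N)
      case 0
      then show ?thesis using L_pos assms(14) by simp
    next
      \<comment> \<open>The test still fails at \<open>m\<close>, and \<open>m + 2\<close> already
        exceeds \<open>N\<close>, so the bound holds even before rounding up.\<close>
      case (Suc m)
      then show ?thesis using index[of m] N(2) by simp
    qed
    then show ?thesis
      by linarith
  qed
  ultimately show ?thesis
    unfolding P_def by blast
qed

end
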